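(* There exist infinitely many permutations of $\mathbb{N}$ (bijections $\mathbb{N}\to\mathbb{N}$) any two distinct of which are infinitely colliding: for any two distinct ones $x=(x_1,x_2,\dots)$ and $y=(y_1,y_2,\dots)$, there are infinitely many positions $n$ with $|x_n-y_n|=1$.
   Context: An infinite permutation is a bijection $x:\mathbb{N}\to\mathbb{N}$, written as the sequence $(x_1,x_2,\dots)$ with $x_n$ the entry in position $n$. Two infinite permutations are infinitely colliding if in infinitely many positions their entries are consecutive integers. *)

theory Defs
  imports Main
begin

(* Positions and entries are indexed by nat, so both start at 0 instead of 1.
   The shift n |-> n + 1 preserves bijectivity and all differences of entries. *)

definition infinite_permutation :: "(nat \<Rightarrow> nat) \<Rightarrow> bool" where
  "infinite_permutation x \<longleftrightarrow> bij x"

(* The difference is taken in int, since subtraction on nat truncates. *)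

definition infinitely_colliding :: "(nat \<Rightarrow> nat) \<Rightarrow> (nat \<Rightarrow> nat) \<Rightarrow> bool" where
  "infinitely_colliding x y \<longleftrightarrow> infinite {n. \<bar>int (x n) - int (y n)\<bar> = 1}"

end

theory Submission
  imports Defs "HOL-Library.Nat_Bijection"
begin

text \<open>
  Swapping the entries \<open>2 i\<close> and \<open>2 i + 1\<close> of the identity for all \<open>i\<close> in a set \<open>A\<close> gives a
  permutation, and the permutations for \<open>A\<close> and \<open>B\<close> have consecutive entries at \<open>2 i\<close> whenever
  \<open>i\<close> lies in exactly one of \<open>A\<close> and \<open>B\<close>. So it is enough to take infinitely many sets with
  pairwise infinite symmetric differences, such as a partition of the naturals into infinitely
  many infinite sets.
\<close>

definition swap_pairs :: "nat set \<Rightarrow> nat \<Rightarrow> nat" where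
  "swap_pairs A n = (if n div 2 \<in> A then if even n then n + 1 else n - 1 else n)"

lemma swap_pairs_involution: "swap_pairs A (swap_pairs A n) = n"
proof (cases "even n")
  case True
  then obtain k where "n = 2 * k" by (elim evenE)
  then show ?thesis by (simp add: swap_pairs_def)
next
  case False
  then obtain k where "n = 2 * k + 1" by (elim oddE)
  then show ?thesis by (simp add: swap_pairs_def)
qed

lemma bij_swap_pairs: "bij (swap_pairs A)"
  by (rule involuntory_imp_bij) (rule swap_pairs_involution)

text \<open>The one-sided difference is enough here, since the sets used later are infinite and
  pairwise disjoint.\<close>

lemma infinitely_colliding_swap_pairs:
  assumes "infinite (A - B)"
  shows "infinitely_colliding (swap_pairs A) (swap_pairs B)"
proof -
  have "infinite ((\<lambda>i. 2 * i) ` (A - B))"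
    using assms by (simp add: finite_image_iff inj_on_def)
  moreover have "(\<lambda>i. 2 * i) ` (A - B)
      \<subseteq> {n. \<bar>int (swap_pairs A n) - int (swap_pairs B n)\<bar> = 1}"
    by (auto simp: swap_pairs_def)
  ultimately show ?thesis
    unfolding infinitely_colliding_def by (rule infinite_super[rotated])
qed

text \<open>The classes of the partition: \<open>prod_decode\<close> is a bijection onto pairs, and
  each first coordinate occurs in infinitely many pairs.\<close>

definition decode_fiber :: "nat \<Rightarrow> nat set" where
  "decode_fiber k = {i. fst (prod_decode i) = k}"

lemma infinite_decode_fiber: "infinite (decode_fiber k)"
proof -
  have "inj (\<lambda>m. prod_encode (k, m))"
    by (simp add: inj_def)
  then have "infinite (range (\<lambda>m. prod_encode (k, m)))"
    using finite_imageD infinite_UNIV_nat by blast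
  moreover have "range (\<lambda>m. prod_encode (k, m)) \<subseteq> decode_fiber k"
    by (auto simp: decode_fiber_def)
  ultimately show ?thesis
    by (rule infinite_super[rotated])
qed

lemma infinitely_colliding_decode_fibers:
  assumes "j \<noteq> k"
  shows "infinitely_colliding (swap_pairs (decode_fiber j)) (swap_pairs (decode_fiber k))"
proof -
  have "decode_fiber j - decode_fiber k = decode_fiber j"
    using assms by (auto simp: decode_fiber_def)
  then show ?thesis
    by (simp add: infinitely_colliding_swap_pairs infinite_decode_fiber)
qed

lemma not_infinitely_colliding_self: "\<not> infinitely_colliding x x"
  by (simp add: infinitely_colliding_def)

theorem theorem2:
  shows "\<exists>P :: (nat \<Rightarrow> nat) set. infinite P \<and> (\<forall>x\<in>P. infinite_permutation x) \<and>
    (\<forall>x\<in>P. \<forall>y\<in>P. x \<noteq> y \<longrightarrow> infinitely_colliding x y)"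
proof (intro exI conjI ballI impI)
  let ?f = "\<lambda>k. swap_pairs (decode_fiber k)"
  \<comment> \<open>Distinct indices give infinitely colliding permutations, which cannot be equal
    since nothing collides with itself.\<close>
  have "inj ?f"
    by (rule injI) (metis infinitely_colliding_decode_fibers not_infinitely_colliding_self)
  then show "infinite (range ?f)"
    using finite_imageD infinite_UNIV_nat by blast
  show "infinite_permutation x" if "x \<in> range ?f" for x
    using that by (auto simp: infinite_permutation_def bij_swap_pairs)
  show "infinitely_colliding x y" if xy: "x \<in> range ?f" "y \<in> range ?f" "x \<noteq> y" for x y
  proof -
    obtain j k where "x = ?f j" "y = ?f k"
      using xy(1,2) by auto
    moreover from this have "j \<noteq> k"
      using xy(3) by auto
    ultimately show ?thesis
      by (simp add: infinitely_colliding_decode_fibers)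
  qed
qed

end
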